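(* Let $i,j\in\mathbb{S}$ be orthogonal and let $\mu_i$ be a non-trivial $q$-positive probability measure on $\mathbb{T}_i$ with Verblunsky coefficients $(\gamma_n)_{n=0}^\infty$ and orthonormal polynomials $(\psi_n^L)_{n=0}^\infty$ and $(\psi_n^R)_{n=0}^\infty$. Set $r_n:=\sqrt{1-|\gamma_n|^2}$. Then for all integers $n\ge0$ and all $p\in\mathbb{H}$: for the left polynomials, $$\psi_{n+1}^L(p)=r_n^{-1}\big(\psi_n^L(p)\,p-\overline{\gamma_n}\,\psi_n^{R,\#}(p)\big),\qquad \psi_{n+1}^{L,\#}(p)=r_n^{-1}\big(\psi_n^{L,\#}(p)-p\,\psi_n^R(p)\,\gamma_n\big),$$ and for the right polynomials, $$\psi_{n+1}^R(p)=r_n^{-1}\big(p\,\psi_n^R(p)-\psi_n^{L,\#}(p)\,\overline{\gamma_n}\big),\qquad \psi_{n+1}^{R,\#}(p)=r_n^{-1}\big(\psi_n^{R,\#}(p)-\gamma_n\,\psi_n^L(p)\,p\big).$$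
   Context: $\mathbb{H}$ is the quaternions, $\mathbb{S}$ the sphere of purely imaginary unit quaternions (so $i^2=-1$ for $i\in\mathbb{S}$). For $i\in\mathbb{S}$: $\mathbb{C}_i=\mathbb{R}+\mathbb{R}i$, $\mathbb{T}_i$ is its unit circle. If $i,j\in\mathbb{S}$ are orthogonal (as vectors in $\mathbb{R}^3$), every quaternion is uniquely $p^{(1)}+p^{(2)}j$ with $p^{(1)},p^{(2)}\in\mathbb{C}_i$. A quaternion-valued measure $\mu_i=\mu^{(1)}+\mu^{(2)}j$ on $\mathbb{T}_i$ ($\mu^{(1)},\mu^{(2)}$ being $\mathbb{C}_i$-valued) is $q$-positive if $\mu^{(1)}$ is a positive measure, $\int_0^{2\pi} e^{in\theta}\mathrm{d}\mu^{(2)}(\theta)=-\int_0^{2\pi} e^{-in\theta}\mathrm{d}\mu^{(2)}(\theta)$ for all $n\in\mathbb{Z}$, and the measure $\begin{bmatrix}\mu^{(1)}&\mu^{(2)}\\ \overline{\mu^{(2)}}&\nu\end{bmatrix}$ is positive semidefinite-valued, where $\int_0^{2\pi} e^{in\theta}\mathrm{d}\nu(\theta)=\int_0^{2\pi} e^{-in\theta}\mathrm{d}\mu^{(1)}(\theta)$ for all $n\in\mathbb{Z}$. Its moments are $c_n=\int_0^{2\pi}e^{in\theta}\mathrm{d}\mu_i(\theta)\in\mathbb{H}$, $n\in\mathbb{Z}$ (one has $c_{-n}=\overline{c_n}$). It is a probability $q$-positive measure if $c_0=1$. It is non-trivial if for every $n\ge0$ the quaternionic Toeplitz matrix $T_n(c)=[c_{\ell-k}]_{k,\ell=0}^n$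 (row $k$, column $\ell$) is positive definite, i.e. $\xi^*T_n(c)\xi>0$ for all nonzero $\xi\in\mathbb{H}^{n+1}$. Orthonormal polynomials. $\mathbb{H}[p]^L$ is the set of polynomials $\sum_k p^k\varphi_k$ and $\mathbb{H}[p]^R$ the set of polynomials $\sum_k\varphi_kp^k$, with $\varphi_k\in\mathbb{H}$. On $\mathbb{H}[p]^L$ put $\langle\varphi,\psi\rangle_R=\sum_{k,\ell}\overline{\psi_\ell}\,c_{k-\ell}\,\varphi_k$; on $\mathbb{H}[p]^R$ put $\langle\varphi,\psi\rangle_L=\sum_{k,\ell}\varphi_k\,c_{k-\ell}\,\overline{\psi_\ell}$. The right-orthonormal polynomials $(\psi_n^R)_{n\ge0}\subset\mathbb{H}[p]^L$ (coefficients on the right) and the left-orthonormal polynomials $(\psi_n^L)_{n\ge0}\subset\mathbb{H}[p]^R$ (coefficients on the left) are obtained from $1,p,p^2,\dots$ by the Gram–Schmidt algorithm with respect to $\langle\cdot,\cdot\rangle_R$ and $\langle\cdot,\cdot\rangle_L$ respectively; thus $\psi_n^{R},\psi_n^L$ have degree $n$ and positive real leading coefficient. Reverse polynomials: for $\varphi(p)=\sum_{k=0}^np^k\varphi_k\in\mathbb{H}[p]^L$ of degree $n$, $\varphi^\#(p)=\overline{\varphi(1/\overline p)}\,p^n=\sum_k\overline{\varphi_k}\,p^{n-k}\in\mathbb{H}[p]^R$; for $\psi(p)=\sum_{k=0}^n\psi_kp^k\in\mathbb{H}[p]^R$ of degree $n$, $\psi^\#(p)=p^n\,\overline{\psi(1/\overline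 p)}=\sum_kp^{n-k}\,\overline{\psi_k}\in\mathbb{H}[p]^L$. Write $\psi_n^{L,\#}=(\psi_n^L)^\#$, $\psi_n^{R,\#}=(\psi_n^R)^\#$. Verblunsky coefficients. For power series with right coefficients the $\star$-product is $(\sum p^ka_k)\star(\sum p^kb_k)=\sum_np^n\sum_{k=0}^na_kb_{n-k}$, and $g^{-\star}$ is the $\star$-inverse. Let $F(p)=1+2\sum_{n\ge1}p^nc_{-n}$ for $|p|<1$ (so that $F(z)=\int_0^{2\pi}\frac{1+ze^{-i\theta}}{1-ze^{-i\theta}}\mathrm{d}\mu_i(\theta)$ for $z\in\mathbb{C}_i$, $|z|<1$), and let $f$ be the quaternionic Schur function with $F=(1+pf)\star(1-pf)^{-\star}$. The Verblunsky coefficients are given by the quaternionic Schur algorithm: $f_0=f$, $\gamma_n=f_n(0)$, $p\,f_{n+1}(p)=(f_n-\gamma_n)\star(1-\overline{\gamma_n}\star f_n)^{-\star}(p)$; they satisfy $|\gamma_n|<1$. *)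

theory Defs
  imports "HOL-Analysis.Analysis" "HOL-Computational_Algebra.Computational_Algebra"
begin

section \<open>Quaternions\<close>

datatype quat = Quat (qRe: real) (qIm1: real) (qIm2: real) (qIm3: real)

lemma quat_eq_iff:
  "x = y \<longleftrightarrow> qRe x = qRe y \<and> qIm1 x = qIm1 y \<and> qIm2 x = qIm2 y \<and> qIm3 x = qIm3 y"
  by (cases x; cases y) simp

instantiation quat :: ab_group_add
begin

definition "0 = Quat 0 0 0 0"
definition "x + y = Quat (qRe x + qRe y) (qIm1 x + qIm1 y) (qIm2 x + qIm2 y) (qIm3 x + qIm3 y)"
definition "- x = Quat (- qRe x) (- qIm1 x) (- qIm2 x) (- qIm3 x)"
definition "x - y = Quat (qRe x - qRe y) (qIm1 x - qIm1 y) (qIm2 x - qIm2 y) (qIm3 x - qIm3 y)"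

instance
  by standard
    (simp_all add: zero_quat_def plus_quat_def uminus_quat_def minus_quat_def quat_eq_iff)

end

lemma quat_add_sel [simp]:
  "qRe 0 = 0" "qIm1 0 = 0" "qIm2 0 = 0" "qIm3 0 = 0"
  "qRe (x + y) = qRe x + qRe y" "qIm1 (x + y) = qIm1 x + qIm1 y"
  "qIm2 (x + y) = qIm2 x + qIm2 y" "qIm3 (x + y) = qIm3 x + qIm3 y"
  "qRe (- x) = - qRe x" "qIm1 (- x) = - qIm1 x" "qIm2 (- x) = - qIm2 x" "qIm3 (- x) = - qIm3 x"
  "qRe (x - y) = qRe x - qRe y" "qIm1 (x - y) = qIm1 x - qIm1 y"
  "qIm2 (x - y) = qIm2 x - qIm2 y" "qIm3 (x - y) = qIm3 x - qIm3 y"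
  by (simp_all add: zero_quat_def plus_quat_def uminus_quat_def minus_quat_def)

instantiation quat :: real_vector
begin

definition "a *\<^sub>R x = Quat (a * qRe x) (a * qIm1 x) (a * qIm2 x) (a * qIm3 x)" for x :: quat

instance
  by standard (simp_all add: scaleR_quat_def quat_eq_iff algebra_simps)

end

lemma quat_scaleR_sel [simp]:
  "qRe (a *\<^sub>R x) = a * qRe x" "qIm1 (a *\<^sub>R x) = a * qIm1 x"
  "qIm2 (a *\<^sub>R x) = a * qIm2 x" "qIm3 (a *\<^sub>R x) = a * qIm3 x"
  by (simp_all add: scaleR_quat_def)

instantiation quat :: real_inner
begin

definition "inner x y = qRe x * qRe y + qIm1 x * qIm1 y + qIm2 x * qIm2 y + qIm3 x * qIm3 y"
definition "norm x = sqrt ((qRe x)\<^sup>2 + (qIm1 x)\<^sup>2 + (qIm2 x)\<^sup>2 + (qIm3 x)\<^sup>2)"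
definition "sgn x = x /\<^sub>R norm x" for x :: quat
definition "dist x y = norm (x - y)" for x y :: quat
definition uniformity_quat_def [code del]:
  "(uniformity :: (quat \<times> quat) filter) = (INF e\<in>{0<..}. principal {(x, y). dist x y < e})"
definition open_quat_def [code del]:
  "open (U :: quat set) \<longleftrightarrow> (\<forall>x\<in>U. eventually (\<lambda>(x', y). x' = x \<longrightarrow> y \<in> U) uniformity)"

instance
proof
  fix x :: quat
  have *: "inner x x = (qRe x)\<^sup>2 + (qIm1 x)\<^sup>2 + (qIm2 x)\<^sup>2 + (qIm3 x)\<^sup>2"
    by (simp add: inner_quat_def power2_eq_square)
  show "0 \<le> inner x x" and "norm x = sqrt (inner x x)"
    unfolding * norm_quat_def by auto
  have "inner x x = 0 \<longleftrightarrow> (qRe x)\<^sup>2 = 0 \<and> (qIm1 x)\<^sup>2 = 0 \<and> (qIm2 x)\<^sup>2 = 0 \<and> (qIm3 x)\<^sup>2 = 0"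
    unfolding * by (simp add: add_nonneg_eq_0_iff)
  then show "inner x x = 0 \<longleftrightarrow> x = 0"
    by (simp add: quat_eq_iff)
qed (simp_all add: inner_quat_def sgn_quat_def dist_quat_def
      uniformity_quat_def open_quat_def quat_eq_iff algebra_simps)

end

definition qcnj :: "quat \<Rightarrow> quat"
  where "qcnj x = Quat (qRe x) (- qIm1 x) (- qIm2 x) (- qIm3 x)"

instantiation quat :: real_normed_div_algebra
begin

definition "1 = Quat 1 0 0 0"
definition "x * y = Quat
  (qRe x * qRe y - qIm1 x * qIm1 y - qIm2 x * qIm2 y - qIm3 x * qIm3 y)
  (qRe x * qIm1 y + qIm1 x * qRe y + qIm2 x * qIm3 y - qIm3 x * qIm2 y)
  (qRe x * qIm2 y - qIm1 x * qIm3 y + qIm2 x * qRe y + qIm3 x * qIm1 y)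
  (qRe x * qIm3 y + qIm1 x * qIm2 y - qIm2 x * qIm1 y + qIm3 x * qRe y)"
definition "inverse x = qcnj x /\<^sub>R (norm x)\<^sup>2"
definition "x div y = x * inverse y" for x y :: quat

instance
proof
  fix x y :: quat
  have norm2: "(norm x)\<^sup>2 = (qRe x)\<^sup>2 + (qIm1 x)\<^sup>2 + (qIm2 x)\<^sup>2 + (qIm3 x)\<^sup>2" for x :: quat
    by (simp add: norm_quat_def)
  show "norm (x * y) = norm x * norm y"
    unfolding norm_quat_def real_sqrt_mult [symmetric]
    by (simp add: times_quat_def power2_eq_square algebra_simps)
  have *: "x * qcnj x = (norm x)\<^sup>2 *\<^sub>R 1" "qcnj x * x = (norm x)\<^sup>2 *\<^sub>R 1"
    unfolding norm2
    by (simp_all add: times_quat_def qcnj_def one_quat_def quat_eq_iff power2_eq_square)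
  have s: "a * (r *\<^sub>R b) = r *\<^sub>R (a * b)" "(r *\<^sub>R a) * b = r *\<^sub>R (a * b)" for a b :: quat and r
    by (simp_all add: times_quat_def quat_eq_iff algebra_simps)
  show "x \<noteq> 0 \<Longrightarrow> inverse x * x = 1" "x \<noteq> 0 \<Longrightarrow> x * inverse x = 1"
    by (simp_all add: inverse_quat_def s *)
  show "inverse (0 :: quat) = 0"
    by (simp add: inverse_quat_def)
qed (simp_all add: times_quat_def one_quat_def divide_quat_def quat_eq_iff algebra_simps)

end

instantiation quat :: euclidean_space
begin

definition "Basis = {Quat 1 0 0 0, Quat 0 1 0 0, Quat 0 0 1 0, Quat 0 0 0 1}"

instance
proof
  fix x u v :: quat
  show "(Basis :: quat set) \<noteq> {}" "finite (Basis :: quat set)"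
    by (simp_all add: Basis_quat_def)
  show "u \<in> Basis \<Longrightarrow> v \<in> Basis \<Longrightarrow> inner u v = (if u = v then 1 else 0)"
    by (simp add: Basis_quat_def inner_quat_def) (elim disjE; simp)
  show "(\<forall>u\<in>Basis. inner x u = 0) \<longleftrightarrow> x = 0"
    by (auto simp: Basis_quat_def inner_quat_def zero_quat_def intro: quat.expand)
qed

end

definition q_nonneg :: "quat \<Rightarrow> bool"
  where "q_nonneg x \<longleftrightarrow> x \<in> \<real> \<and> 0 \<le> qRe x"

definition q_pos :: "quat \<Rightarrow> bool"
  where "q_pos x \<longleftrightarrow> x \<in> \<real> \<and> 0 < qRe x"

definition imag_units :: "quat set"
  where "imag_units = {x. qRe x = 0 \<and> norm x = 1}"

definition slice :: "quat \<Rightarrow> quat set"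
  where "slice i = {of_real a + of_real b * i | a b. True}"

definition slice_circle :: "quat \<Rightarrow> quat set"
  where "slice_circle i = {z \<in> slice i. norm z = 1}"


section \<open>Quaternion-valued measures on the circle\<close>

text \<open>A vector measure is a set function that is countably additive on a \<open>\<sigma>\<close>-algebra. A measure
  \<open>M\<close> is used only as a carrier of the \<open>\<sigma>\<close>-algebra \<open>sets M\<close> on \<open>space M\<close>.\<close>

definition vector_measure :: "'a measure \<Rightarrow> ('a set \<Rightarrow> 'b::real_normed_vector) \<Rightarrow> bool"
  where "vector_measure M \<mu> \<longleftrightarrow>
    (\<forall>A :: nat \<Rightarrow> 'a set. range A \<subseteq> sets M \<longrightarrow> disjoint_family A \<longrightarrow>
      (\<lambda>n. \<mu> (A n)) sums \<mu> (\<Union>n. A n))"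

text \<open>The positive part of the Jordan decomposition of a finite signed measure \<open>s\<close>; the negative
  part is the positive part of \<open>- s\<close>.\<close>

definition jordan_pos :: "'a measure \<Rightarrow> ('a set \<Rightarrow> real) \<Rightarrow> 'a measure"
  where "jordan_pos M s = measure_of (space M) (sets M)
    (\<lambda>A. ennreal (SUP B \<in> {B \<in> sets M. B \<subseteq> A}. s B))"

definition signed_integral ::
    "'a measure \<Rightarrow> ('a set \<Rightarrow> real) \<Rightarrow> ('a \<Rightarrow> 'b::{banach, second_countable_topology}) \<Rightarrow> 'b"
  where "signed_integral M s f =
    integral\<^sup>L (jordan_pos M s) f - integral\<^sup>L (jordan_pos M (\<lambda>A. - s A)) f"

text \<open>The integral \<open>\<integral> f d\<mu>\<close>, with the integrand to the left of the measure, obtained by expanding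
  \<open>\<mu>\<close> into its four real components.\<close>

definition quat_integral ::
    "'a measure \<Rightarrow> ('a set \<Rightarrow> quat) \<Rightarrow> ('a \<Rightarrow> quat) \<Rightarrow> quat"
  where "quat_integral M \<mu> f = (\<Sum>e\<in>Basis. signed_integral M (\<lambda>A. inner (\<mu> A) e) f * e)"

lemma signed_integral_finite_measure:
  fixes N :: "'a measure" and f :: "'a \<Rightarrow> 'b::{banach, second_countable_topology}"
  assumes "finite_measure N" and sets: "sets N = sets M"
  shows "signed_integral M (measure N) f = integral\<^sup>L N f"
proof -
  interpret finite_measure N by fact
  have space: "space N = space M"
    using sets by (rule sets_eq_imp_space_eq)
  have "(SUP B \<in> {B \<in> sets M. B \<subseteq> A}. measure N B) = measure N A" if "A \<in> sets M" for A
    by (rule cSup_eq_maximum) (use that sets in \<open>auto intro!: finite_measure_mono\<close>)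
  then have "jordan_pos M (measure N) = measure_of (space N) (sets N) (emeasure N)"
    unfolding jordan_pos_def space sets
    by (intro measure_of_eq) (simp_all add: sets.space_closed sets.sigma_sets_eq emeasure_eq_measure)
  then have pos: "jordan_pos M (measure N) = N"
    by (simp add: measure_of_of_measure)
  have "(SUP B \<in> {B \<in> sets M. B \<subseteq> A}. - measure N B) = 0" for A
    by (rule cSup_eq_maximum) (auto intro!: image_eqI [where x = "{}"])
  then have "jordan_pos M (\<lambda>A. - measure N A) = null_measure M"
    unfolding jordan_pos_def null_measure_def by simp
  then show ?thesis
    by (simp add: signed_integral_def pos)
qed

definition circle_borel :: "quat \<Rightarrow> quat measure"
  where "circle_borel i = restrict_space borel (slice_circle i)"

definition slice_measure :: "quat \<Rightarrow> (quat set \<Rightarrow> quat) \<Rightarrow> bool"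
  where "slice_measure i \<mu> \<longleftrightarrow>
    vector_measure (circle_borel i) \<mu> \<and> (\<forall>A \<in> sets (circle_borel i). \<mu> A \<in> slice i)"

text \<open>The \<open>n\<close>-th trigonometric moment. A measure in the angle \<open>\<theta> \<in> [0, 2\<pi>)\<close> is regarded as a
  measure in the point \<open>z = cos \<theta> + i sin \<theta>\<close> of the circle, so that \<open>z powi n\<close> is the
  integrand \<open>cos n\<theta> + i sin n\<theta>\<close>.\<close>

definition moment :: "quat \<Rightarrow> (quat set \<Rightarrow> quat) \<Rightarrow> int \<Rightarrow> quat"
  where "moment i \<mu> n = quat_integral (circle_borel i) \<mu> (\<lambda>z. z powi n)"

text \<open>Positive semidefiniteness of a \<open>2 \<times> 2\<close> matrix with rows \<open>(a, b)\<close> and \<open>(c, d)\<close> over the field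
  \<open>slice i\<close>.\<close>

definition slice_psd :: "quat \<Rightarrow> quat \<Rightarrow> quat \<Rightarrow> quat \<Rightarrow> quat \<Rightarrow> bool"
  where "slice_psd i a b c d \<longleftrightarrow> (\<forall>x \<in> slice i. \<forall>y \<in> slice i.
    q_nonneg (qcnj x * a * x + qcnj x * b * y + qcnj y * c * x + qcnj y * d * y))"

definition q_positive :: "quat \<Rightarrow> quat \<Rightarrow> (quat set \<Rightarrow> quat) \<Rightarrow> bool"
  where "q_positive i j \<mu> \<longleftrightarrow>
    (\<exists>\<mu>1 \<mu>2 \<nu>. slice_measure i \<mu>1 \<and> slice_measure i \<mu>2 \<and> slice_measure i \<nu> \<and>
      (\<forall>A \<in> sets (circle_borel i). \<mu> A = \<mu>1 A + \<mu>2 A * j) \<and>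
      (\<forall>A \<in> sets (circle_borel i). q_nonneg (\<mu>1 A)) \<and>
      (\<forall>n. moment i \<mu>2 n = - moment i \<mu>2 (- n)) \<and>
      (\<forall>n. moment i \<nu> n = moment i \<mu>1 (- n)) \<and>
      (\<forall>A \<in> sets (circle_borel i). slice_psd i (\<mu>1 A) (\<mu>2 A) (qcnj (\<mu>2 A)) (\<nu> A)))"

definition toeplitz :: "(int \<Rightarrow> quat) \<Rightarrow> nat \<Rightarrow> nat \<Rightarrow> quat"
  where "toeplitz c k l = c (int l - int k)"

text \<open>Positive definiteness of the matrix with entries \<open>T k l\<close>, \<open>0 \<le> k, l \<le> n\<close>.\<close>

definition quat_pos_def :: "nat \<Rightarrow> (nat \<Rightarrow> nat \<Rightarrow> quat) \<Rightarrow> bool"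
  where "quat_pos_def n T \<longleftrightarrow> (\<forall>\<xi> :: nat \<Rightarrow> quat. (\<exists>k\<le>n. \<xi> k \<noteq> 0) \<longrightarrow>
    q_pos (\<Sum>k\<le>n. \<Sum>l\<le>n. qcnj (\<xi> k) * T k l * \<xi> l))"

definition q_nontrivial :: "quat \<Rightarrow> (quat set \<Rightarrow> quat) \<Rightarrow> bool"
  where "q_nontrivial i \<mu> \<longleftrightarrow> (\<forall>n. quat_pos_def n (toeplitz (moment i \<mu>)))"


section \<open>Orthonormal polynomials\<close>

text \<open>Polynomials of both kinds are represented by their coefficients, as elements of
  \<open>quat poly\<close>; they differ in the side on which the coefficients stand on evaluation.
  \<open>eval_rcoeff\<close> evaluates polynomials with coefficients on the right (this is where the
  right-orthonormal polynomials live), \<open>eval_lcoeff\<close> those with coefficients on the left.\<close>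

definition eval_rcoeff :: "quat poly \<Rightarrow> quat \<Rightarrow> quat"
  where "eval_rcoeff \<phi> p = (\<Sum>k\<le>degree \<phi>. p ^ k * coeff \<phi> k)"

definition eval_lcoeff :: "quat poly \<Rightarrow> quat \<Rightarrow> quat"
  where "eval_lcoeff \<phi> p = (\<Sum>k\<le>degree \<phi>. coeff \<phi> k * p ^ k)"

definition inner_R :: "(int \<Rightarrow> quat) \<Rightarrow> quat poly \<Rightarrow> quat poly \<Rightarrow> quat"
  where "inner_R c \<phi> \<psi> = (\<Sum>k\<le>degree \<phi>. \<Sum>l\<le>degree \<psi>.
    qcnj (coeff \<psi> l) * c (int k - int l) * coeff \<phi> k)"

definition inner_L :: "(int \<Rightarrow> quat) \<Rightarrow> quat poly \<Rightarrow> quat poly \<Rightarrow> quat"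
  where "inner_L c \<phi> \<psi> = (\<Sum>k\<le>degree \<phi>. \<Sum>l\<le>degree \<psi>.
    coeff \<phi> k * c (int k - int l) * qcnj (coeff \<psi> l))"

text \<open>Gram--Schmidt applied to \<open>1, p, p\<^sup>2, \<dots>\<close>. Scalars act on the right for \<open>inner_R\<close> and on the
  left for \<open>inner_L\<close>.\<close>

fun orthonormal_R :: "(int \<Rightarrow> quat) \<Rightarrow> nat \<Rightarrow> quat poly"
  where "orthonormal_R c n =
    (let \<phi> = monom 1 n - (\<Sum>k<n. map_poly (\<lambda>a. a * inner_R c (monom 1 n) (orthonormal_R c k))
                                  (orthonormal_R c k))
     in map_poly (\<lambda>a. a /\<^sub>R sqrt (qRe (inner_R c \<phi> \<phi>))) \<phi>)"

fun orthonormal_L :: "(int \<Rightarrow> quat) \<Rightarrow> nat \<Rightarrow> quat poly"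
  where "orthonormal_L c n =
    (let \<phi> = monom 1 n - (\<Sum>k<n. map_poly (\<lambda>a. inner_L c (monom 1 n) (orthonormal_L c k) * a)
                                  (orthonormal_L c k))
     in map_poly (\<lambda>a. a /\<^sub>R sqrt (qRe (inner_L c \<phi> \<phi>))) \<phi>)"

declare orthonormal_R.simps [simp del] orthonormal_L.simps [simp del]

text \<open>The reverse of a polynomial of degree \<open>n\<close>; the coefficient of \<open>p\<^sup>n\<^sup>-\<^sup>k\<close> is the conjugate of
  that of \<open>p\<^sup>k\<close>. The coefficients change side, so the reverse of an \<open>orthonormal_R\<close> is evaluated by
  \<open>eval_lcoeff\<close> and that of an \<open>orthonormal_L\<close> by \<open>eval_rcoeff\<close>.\<close>

definition reverse_poly :: "quat poly \<Rightarrow> quat poly"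
  where "reverse_poly \<phi> = map_poly qcnj (reflect_poly \<phi>)"


section \<open>Verblunsky coefficients\<close>

text \<open>Power series \<open>\<Sum>n. p\<^sup>n a\<^sub>n\<close> with right coefficients are elements of \<open>quat fps\<close>. Multiplication
  of formal power series is the \<open>\<star>\<close>-product, and \<open>inverse\<close> is the \<open>\<star>\<close>-inverse of a series with
  non-zero constant coefficient.\<close>

definition caratheodory_series :: "(int \<Rightarrow> quat) \<Rightarrow> quat fps"
  where "caratheodory_series c = Abs_fps (\<lambda>n. if n = 0 then 1 else 2 * c (- int n))"

definition quat_schur :: "quat fps \<Rightarrow> bool"
  where "quat_schur f \<longleftrightarrow> (\<forall>p. norm p < 1 \<longrightarrow>
    summable (\<lambda>n. p ^ n * fps_nth f n) \<and> norm (\<Sum>n. p ^ n * fps_nth f n) \<le> 1)"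

text \<open>The series \<open>(f\<^sub>n - \<gamma>\<^sub>n) \<star> (1 - \<gamma>\<^sub>n\<^sup>* \<star> f\<^sub>n)\<^sup>-\<^sup>\<star>\<close> has no constant term, and
  \<open>fps_shift 1\<close> divides it by \<open>p\<close>.\<close>

fun schur_iterate :: "quat fps \<Rightarrow> nat \<Rightarrow> quat fps"
  where
    "schur_iterate f 0 = f"
  | "schur_iterate f (Suc n) =
      (let g = schur_iterate f n; \<gamma> = fps_nth g 0
       in fps_shift 1 ((g - fps_const \<gamma>) * inverse (1 - fps_const (qcnj \<gamma>) * g)))"

definition verblunsky_coeffs :: "(int \<Rightarrow> quat) \<Rightarrow> (nat \<Rightarrow> quat) \<Rightarrow> bool"
  where "verblunsky_coeffs c \<gamma> \<longleftrightarrow> (\<exists>f. quat_schur f \<and>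
    caratheodory_series c = (1 + fps_X * f) * inverse (1 - fps_X * f) \<and>
    (\<forall>n. \<gamma> n = fps_nth (schur_iterate f n) 0))"

end

theory Submission
  imports Defs
begin

text \<open>The measure enters only through its moments: positive definiteness of the Toeplitz matrices
  already forces \<open>c (- m) = qcnj (c m)\<close>. Run the recursion, without the factors \<open>r n\<close>, with the Schur
  parameters of \<open>f\<close>, and let \<open>u n l\<close> be the product of its \<open>n\<close>-th right polynomial with \<open>p ^ l\<close> and
  \<open>v n l\<close> the same for the conjugate data. Then
  \<open>u (n + 1) l = u n (l - 1) - v n (n - l) * qcnj (\<gamma> n)\<close>, and by induction \<open>u n l = 0\<close> for
  \<open>0 \<le> l < n\<close>, while \<open>u n (n + m)\<close> and \<open>v n (- 1 - m)\<close> are the \<open>m\<close>-th coefficients of \<open>G n\<close> and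
  \<open>G n * f n\<close> for a power series \<open>G n\<close>: the Schur iterate \<open>f n\<close> is a quotient of the two residuals,
  and the Schur step is exactly the recursion for this quotient. So the monic polynomials are
  orthogonal, and their squared norms are the products of the factors \<open>1 - (norm (\<gamma> k))\<^sup>2\<close>.\<close>


section \<open>Quaternions, polynomials and power series\<close>

lemma qcnj_sel [simp]:
  "qRe (qcnj x) = qRe x" "qIm1 (qcnj x) = - qIm1 x"
  "qIm2 (qcnj x) = - qIm2 x" "qIm3 (qcnj x) = - qIm3 x"
  by (simp_all add: qcnj_def)

lemma quat_mult_sel:
  "qRe (x * y) = qRe x * qRe y - qIm1 x * qIm1 y - qIm2 x * qIm2 y - qIm3 x * qIm3 y"
  "qIm1 (x * y) = qRe x * qIm1 y + qIm1 x * qRe y + qIm2 x * qIm3 y - qIm3 x * qIm2 y"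
  "qIm2 (x * y) = qRe x * qIm2 y - qIm1 x * qIm3 y + qIm2 x * qRe y + qIm3 x * qIm1 y"
  "qIm3 (x * y) = qRe x * qIm3 y + qIm1 x * qIm2 y - qIm2 x * qIm1 y + qIm3 x * qRe y"
  by (simp_all add: times_quat_def)

lemma of_real_sel [simp]:
  "qRe (of_real a) = a" "qIm1 (of_real a) = 0" "qIm2 (of_real a) = 0" "qIm3 (of_real a) = 0"
  by (simp_all add: of_real_def one_quat_def)

lemma qcnj_qcnj [simp]: "qcnj (qcnj x) = x"
  by (simp add: quat_eq_iff)

lemma qcnj_0 [simp]: "qcnj 0 = 0"
  by (simp add: quat_eq_iff)

lemma qcnj_1 [simp]: "qcnj 1 = 1"
  by (simp add: quat_eq_iff one_quat_def)

lemma qcnj_eq_0_iff [simp]: "qcnj x = 0 \<longleftrightarrow> x = 0"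
  by (simp add: quat_eq_iff)

lemma qcnj_add: "qcnj (x + y) = qcnj x + qcnj y"
  by (simp add: quat_eq_iff)

lemma qcnj_diff: "qcnj (x - y) = qcnj x - qcnj y"
  by (simp add: quat_eq_iff)

lemma qcnj_mult: "qcnj (x * y) = qcnj y * qcnj x"
  by (simp add: quat_eq_iff quat_mult_sel algebra_simps)

lemma qcnj_scaleR: "qcnj (a *\<^sub>R x) = a *\<^sub>R qcnj x"
  by (simp add: quat_eq_iff)

lemma qcnj_sum: "qcnj (sum g A) = (\<Sum>x\<in>A. qcnj (g x))"
  by (induction A rule: infinite_finite_induct) (simp_all add: qcnj_add)

lemma qcnj_power: "qcnj (x ^ n) = qcnj x ^ n"
  by (induction n) (simp_all add: qcnj_mult power_commutes)

lemma norm_qcnj [simp]: "norm (qcnj x) = norm x"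
  by (simp add: norm_quat_def)

lemma mult_qcnj: "x * qcnj x = of_real ((norm x)\<^sup>2)"
  by (simp add: quat_eq_iff quat_mult_sel norm_quat_def power2_eq_square)

lemma qcnj_mult_self: "qcnj x * x = of_real ((norm x)\<^sup>2)"
  using mult_qcnj [of "qcnj x"] by simp

lemma quat_Reals_iff: "x \<in> \<real> \<longleftrightarrow> qcnj x = x"
proof
  show "x \<in> \<real> \<Longrightarrow> qcnj x = x"
    by (auto elim!: Reals_cases simp: quat_eq_iff)
  assume "qcnj x = x"
  then have "x = of_real (qRe x)"
    by (simp add: quat_eq_iff)
  then show "x \<in> \<real>"
    by (metis Reals_of_real)
qed

lemma q_pos_of_real [simp]: "q_pos (of_real a) \<longleftrightarrow> 0 < a"
  by (simp add: q_pos_def)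

section \<open>Right multiples, conjugates and evaluations of polynomials\<close>

definition rmult_poly :: "quat poly \<Rightarrow> quat \<Rightarrow> quat poly"
  where "rmult_poly \<phi> a = map_poly (\<lambda>x. x * a) \<phi>"

lemma coeff_rmult_poly [simp]: "coeff (rmult_poly \<phi> a) k = coeff \<phi> k * a"
  by (simp add: rmult_poly_def coeff_map_poly)

lemma rmult_poly_of_real: "rmult_poly \<phi> (of_real a) = map_poly (\<lambda>x. a *\<^sub>R x) \<phi>"
  by (rule poly_eqI) (simp add: coeff_map_poly scaleR_conv_of_real Reals_of_real quat_eq_iff quat_mult_sel)

lemma degree_rmult_poly_le: "degree (rmult_poly \<phi> a) \<le> degree \<phi>"
  by (rule degree_le) (simp add: coeff_eq_0)

lemma degree_rmult_poly [simp]: "a \<noteq> 0 \<Longrightarrow> degree (rmult_poly \<phi> a) = degree \<phi>"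
  by (simp add: rmult_poly_def degree_map_poly)

definition poly_qcnj :: "quat poly \<Rightarrow> quat poly"
  where "poly_qcnj \<phi> = map_poly qcnj \<phi>"

lemma coeff_poly_qcnj [simp]: "coeff (poly_qcnj \<phi>) k = qcnj (coeff \<phi> k)"
  by (simp add: poly_qcnj_def coeff_map_poly)

lemma degree_poly_qcnj [simp]: "degree (poly_qcnj \<phi>) = degree \<phi>"
  by (simp add: poly_qcnj_def degree_map_poly)

lemma reflect_poly_rmult_poly:
  "a \<noteq> 0 \<Longrightarrow> reflect_poly (rmult_poly \<phi> a) = rmult_poly (reflect_poly \<phi>) a"
  by (rule poly_eqI) (simp add: coeff_reflect_poly)

lemma reverse_poly_eq: "reverse_poly \<phi> = poly_qcnj (reflect_poly \<phi>)"
  by (simp add: reverse_poly_def poly_qcnj_def)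

lemma reverse_poly_qcnj: "reverse_poly (poly_qcnj \<phi>) = reflect_poly \<phi>"
  by (rule poly_eqI) (simp add: reverse_poly_eq coeff_reflect_poly)

lemma eval_rcoeff_bound:
  "degree \<phi> \<le> n \<Longrightarrow> eval_rcoeff \<phi> p = (\<Sum>k\<le>n. p ^ k * coeff \<phi> k)"
  unfolding eval_rcoeff_def by (rule sum.mono_neutral_left) (auto simp: coeff_eq_0)

lemma eval_rcoeff_diff: "eval_rcoeff (\<phi> - \<psi>) p = eval_rcoeff \<phi> p - eval_rcoeff \<psi> p"
proof -
  let ?n = "max (degree \<phi>) (degree \<psi>)"
  have "degree (\<phi> - \<psi>) \<le> ?n"
    by (rule degree_diff_le) auto
  then show ?thesis
    by (simp add: eval_rcoeff_bound [of _ ?n] sum_subtractf algebra_simps)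
qed

lemma eval_rcoeff_rmult_poly: "eval_rcoeff (rmult_poly \<phi> a) p = eval_rcoeff \<phi> p * a"
  by (subst eval_rcoeff_bound [OF degree_rmult_poly_le])
    (simp add: eval_rcoeff_def sum_distrib_right mult.assoc)

lemma eval_rcoeff_pCons_0: "eval_rcoeff (pCons 0 \<phi>) p = p * eval_rcoeff \<phi> p"
proof -
  have "eval_rcoeff (pCons 0 \<phi>) p = (\<Sum>k\<le>Suc (degree \<phi>). p ^ k * coeff (pCons 0 \<phi>) k)"
    by (rule eval_rcoeff_bound) (rule degree_pCons_le)
  also have "\<dots> = p * eval_rcoeff \<phi> p"
    unfolding sum.atMost_Suc_shift by (simp add: eval_rcoeff_def sum_distrib_left mult.assoc)
  finally show ?thesis .
qed

text \<open>Conjugation reverses products and so moves the coefficients to the other side. Left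
  polynomials are treated throughout as conjugates of right ones.\<close>

lemma eval_lcoeff_poly_qcnj: "eval_lcoeff (poly_qcnj \<phi>) p = qcnj (eval_rcoeff \<phi> (qcnj p))"
  by (simp add: eval_lcoeff_def eval_rcoeff_def qcnj_sum qcnj_mult qcnj_power)

section \<open>Conjugation of power series\<close>

definition fps_qcnj :: "quat fps \<Rightarrow> quat fps"
  where "fps_qcnj g = Abs_fps (\<lambda>n. qcnj (fps_nth g n))"

lemma fps_nth_qcnj [simp]: "fps_nth (fps_qcnj g) n = qcnj (fps_nth g n)"
  by (simp add: fps_qcnj_def)

lemma fps_qcnj_mult: "fps_qcnj (g * h) = fps_qcnj h * fps_qcnj g"
proof (rule fps_ext)
  fix n
  show "fps_nth (fps_qcnj (g * h)) n = fps_nth (fps_qcnj h * fps_qcnj g) n"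
    unfolding fps_nth_qcnj fps_mult_nth qcnj_sum qcnj_mult
    by (rule sum.reindex_bij_witness [where i = "\<lambda>k. n - k" and j = "\<lambda>k. n - k"]) auto
qed

lemma fps_qcnj_simps [simp]:
  "fps_qcnj (g - h) = fps_qcnj g - fps_qcnj h"
  "fps_qcnj (fps_const a) = fps_const (qcnj a)"
  "fps_qcnj 1 = 1" "fps_qcnj fps_X = fps_X"
  by (auto intro!: fps_ext simp: qcnj_diff fps_X_def)


section \<open>Gram--Schmidt orthogonalization\<close>

text \<open>For \<open>l \<ge> 0\<close> this is the inner product of \<open>\<phi>\<close> with \<open>p ^ l\<close>. For negative \<open>l\<close> and for
  \<open>l > degree \<phi>\<close> the values are the coefficients of the residual series of the recursion.\<close>

definition inner_power :: "(int \<Rightarrow> quat) \<Rightarrow> quat poly \<Rightarrow> int \<Rightarrow> quat"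
  where "inner_power c \<phi> l = (\<Sum>k\<le>degree \<phi>. c (int k - l) * coeff \<phi> k)"

lemma inner_power_bound:
  "degree \<phi> \<le> n \<Longrightarrow> inner_power c \<phi> l = (\<Sum>k\<le>n. c (int k - l) * coeff \<phi> k)"
  unfolding inner_power_def by (rule sum.mono_neutral_left) (auto simp: coeff_eq_0)

lemma inner_power_diff:
  "inner_power c (\<phi> - \<psi>) l = inner_power c \<phi> l - inner_power c \<psi> l"
proof -
  let ?n = "max (degree \<phi>) (degree \<psi>)"
  have "degree (\<phi> - \<psi>) \<le> ?n"
    by (rule degree_diff_le) auto
  then show ?thesis
    by (simp add: inner_power_bound [of _ ?n] sum_subtractf algebra_simps)
qed

lemma inner_power_rmult_poly: "inner_power c (rmult_poly \<phi> a) l = inner_power c \<phi> l * a"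
  by (subst inner_power_bound [OF degree_rmult_poly_le])
    (simp add: inner_power_def sum_distrib_right mult.assoc)

lemma inner_power_pCons_0: "inner_power c (pCons 0 \<phi>) l = inner_power c \<phi> (l - 1)"
proof -
  have "inner_power c (pCons 0 \<phi>) l =
      (\<Sum>k\<le>Suc (degree \<phi>). c (int k - l) * coeff (pCons 0 \<phi>) k)"
    by (rule inner_power_bound) (rule degree_pCons_le)
  also have "\<dots> = inner_power c \<phi> (l - 1)"
    unfolding sum.atMost_Suc_shift by (simp add: inner_power_def algebra_simps)
  finally show ?thesis .
qed

text \<open>Substituting \<open>degree \<phi> - k\<close> for \<open>k\<close> changes the sign of
  the index of the moments; this is how the conjugate data enter the recursion.\<close>

lemma inner_power_reflect_poly:
  "inner_power c (reflect_poly \<phi>) l =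
    inner_power (\<lambda>m. c (- m)) \<phi> (int (degree \<phi>) - l)"
proof -
  have "inner_power c (reflect_poly \<phi>) l =
      (\<Sum>k\<le>degree \<phi>. c (int k - l) * coeff (reflect_poly \<phi>) k)"
    by (rule inner_power_bound) (rule degree_reflect_poly_le)
  also have "\<dots> = inner_power (\<lambda>m. c (- m)) \<phi> (int (degree \<phi>) - l)"
    unfolding inner_power_def
    by (rule sum.reindex_bij_witness
        [where i = "\<lambda>k. degree \<phi> - k" and j = "\<lambda>k. degree \<phi> - k"])
      (auto simp: coeff_reflect_poly of_nat_diff algebra_simps)
  finally show ?thesis .
qed

lemma inner_R_eq_inner_power:
  "inner_R c \<phi> \<psi> = (\<Sum>l\<le>degree \<psi>. qcnj (coeff \<psi> l) * inner_power c \<phi> (int l))"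
  unfolding inner_R_def inner_power_def sum_distrib_left
  by (subst sum.swap) (simp add: mult.assoc)

lemma inner_R_bound:
  "degree \<psi> \<le> n \<Longrightarrow>
    inner_R c \<phi> \<psi> = (\<Sum>l\<le>n. qcnj (coeff \<psi> l) * inner_power c \<phi> (int l))"
  unfolding inner_R_eq_inner_power by (rule sum.mono_neutral_left) (auto simp: coeff_eq_0)

lemma inner_R_diff_left: "inner_R c (\<phi> - \<psi>) \<eta> = inner_R c \<phi> \<eta> - inner_R c \<psi> \<eta>"
  by (simp add: inner_R_eq_inner_power inner_power_diff sum_subtractf algebra_simps)

lemma inner_R_rmult_left: "inner_R c (rmult_poly \<phi> a) \<psi> = inner_R c \<phi> \<psi> * a"
  by (simp add: inner_R_eq_inner_power inner_power_rmult_poly sum_distrib_right mult.assoc)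

lemma inner_R_sum_left: "inner_R c (sum \<phi> A) \<psi> = (\<Sum>k\<in>A. inner_R c (\<phi> k) \<psi>)"
proof -
  have "inner_R c 0 \<psi> = 0"
    by (simp add: inner_R_def)
  moreover from this have "inner_R c (- \<eta>) \<psi> = - inner_R c \<eta> \<psi>" for \<eta>
    using inner_R_diff_left [of c 0 \<eta> \<psi>] by simp
  then have "inner_R c (\<phi> + \<eta>) \<psi> = inner_R c \<phi> \<psi> + inner_R c \<eta> \<psi>" for \<phi> \<eta>
    using inner_R_diff_left [of c \<phi> "- \<eta>" \<psi>] by simp
  ultimately show ?thesis
    by (induction A rule: infinite_finite_induct) simp_all
qed

lemma inner_R_commute:
  assumes "\<And>m. c (- m) = qcnj (c m)"
  shows "inner_R c \<psi> \<phi> = qcnj (inner_R c \<phi> \<psi>)"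
proof -
  have "qcnj (c (int k - int l)) = c (int l - int k)" for k l
    using assms [of "int k - int l"] by simp
  then show ?thesis
    unfolding inner_R_def by (subst sum.swap) (simp add: qcnj_sum qcnj_mult mult.assoc)
qed

lemma inner_R_rmult_right: "inner_R c \<phi> (rmult_poly \<psi> a) = qcnj a * inner_R c \<phi> \<psi>"
  by (subst inner_R_bound [OF degree_rmult_poly_le])
    (simp add: inner_R_eq_inner_power sum_distrib_left qcnj_mult mult.assoc)

lemma quat_pos_defD:
  assumes "quat_pos_def n T" and "k \<le> n" and "\<xi> k \<noteq> 0"
  shows "q_pos (\<Sum>k\<le>n. \<Sum>l\<le>n. qcnj (\<xi> k) * T k l * \<xi> l)"
  using assms unfolding quat_pos_def_def by blast

text \<open>Up to the order of summation, this is the quadratic form of the Toeplitz matrix at the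
  coefficient vector.\<close>

lemma inner_R_self_pos:
  assumes "\<And>n. quat_pos_def n (toeplitz c)" and "\<phi> \<noteq> 0"
  shows "q_pos (inner_R c \<phi> \<phi>)"
proof -
  have "q_pos (\<Sum>k\<le>degree \<phi>. \<Sum>l\<le>degree \<phi>.
      qcnj (coeff \<phi> k) * toeplitz c k l * coeff \<phi> l)"
    by (rule quat_pos_defD [OF assms(1), of "degree \<phi>"]) (use assms(2) in simp_all)
  then show ?thesis
    unfolding inner_R_def toeplitz_def by (subst sum.swap)
qed

text \<open>Uniqueness: the Gram--Schmidt residual and \<open>\<Phi> n\<close> are both monic of
  degree \<open>n\<close> and orthogonal to all lower degrees. Their difference has lower degree, so
  it is orthogonal to itself and vanishes by positive definiteness.\<close>

lemma orthonormal_R_eq_monic_orthogonal: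
  fixes \<Phi> :: "nat \<Rightarrow> quat poly" and \<beta> :: "nat \<Rightarrow> real"
  assumes hermitian: "\<And>m. c (- m) = qcnj (c m)"
    and pos_def: "\<And>n. quat_pos_def n (toeplitz c)"
    and degree: "\<And>n. degree (\<Phi> n) = n"
    and monic: "\<And>n. coeff (\<Phi> n) n = 1"
    and orthogonal: "\<And>n l. l < n \<Longrightarrow> inner_power c (\<Phi> n) (int l) = 0"
    and square: "\<And>n. inner_power c (\<Phi> n) (int n) = of_real (\<beta> n)"
    and \<beta>_pos: "\<And>n. 0 < \<beta> n"
  shows "orthonormal_R c n = rmult_poly (\<Phi> n) (of_real (inverse (sqrt (\<beta> n))))"
proof (induction n rule: less_induct)
  case (less n)
  define s :: "nat \<Rightarrow> quat" where "s k = of_real (inverse (sqrt (\<beta> k)))" for k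
  define \<psi> where "\<psi> k = rmult_poly (\<Phi> k) (s k)" for k
  have IH: "orthonormal_R c k = \<psi> k" if "k < n" for k
    using less that by (simp add: \<psi>_def s_def)
  have lower: "inner_R c (\<Phi> m) (\<Phi> k) = 0" if "k < m" for k m
    using that by (simp add: inner_R_eq_inner_power degree orthogonal)
  have diagonal: "inner_R c (\<Phi> m) (\<Phi> m) = of_real (\<beta> m)" for m
  proof -
    have "inner_R c (\<Phi> m) (\<Phi> m) =
        (\<Sum>l\<le>m. if l = m then of_real (\<beta> m) else 0)"
      unfolding inner_R_eq_inner_power degree
      by (rule sum.cong) (auto simp: monic square orthogonal)
    then show ?thesis by simp
  qed
  have off_diagonal: "inner_R c (\<Phi> k) (\<Phi> m) = 0" if "k \<noteq> m" for k m
  proof (cases "k < m")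
    case True
    then show ?thesis
      using inner_R_commute [of c "\<Phi> k" "\<Phi> m"] hermitian lower by simp
  next
    case False
    with that show ?thesis
      by (simp add: lower)
  qed
  have orthonormal: "inner_R c (\<psi> k) (\<psi> m) = (if k = m then 1 else 0)" for k m
  proof -
    define t where "t = inverse (sqrt (\<beta> m))"
    have "qcnj (s m) * of_real (\<beta> m) * s m = of_real (t * \<beta> m * t)"
      by (simp add: s_def t_def quat_eq_iff quat_mult_sel del: of_real_inverse of_real_mult)
    also have "t * \<beta> m * t = 1"
      using \<beta>_pos [of m] by (simp add: t_def field_simps)
    finally have "qcnj (s m) * of_real (\<beta> m) * s m = 1"
      by simp
    then show ?thesis
      by (simp add: \<psi>_def inner_R_rmult_left inner_R_rmult_right diagonal off_diagonal mult.assoc)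
  qed
  define \<phi> where
    "\<phi> = monom 1 n - (\<Sum>k<n. rmult_poly (\<psi> k) (inner_R c (monom 1 n) (\<psi> k)))"
  define \<delta> where "\<delta> = \<Phi> n - \<phi>"
  have "inner_R c \<phi> (\<psi> m) = 0" if "m < n" for m
    using that
    by (simp add: \<phi>_def inner_R_diff_left inner_R_sum_left inner_R_rmult_left orthonormal
        if_distrib [of "\<lambda>x. x * _"] cong: if_cong)
  moreover have "s m \<noteq> 0" for m
    using \<beta>_pos [of m] by (simp add: s_def)
  ultimately have "inner_R c \<phi> (\<Phi> m) = 0" if "m < n" for m
    using that by (auto simp: \<psi>_def inner_R_rmult_right)
  then have \<delta>_orthogonal: "inner_R c \<delta> (\<Phi> m) = 0" if "m < n" for m
    using that by (simp add: \<delta>_def inner_R_diff_left lower)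
  \<comment> \<open>Triangularity: the lower powers drop out by induction and
    \<open>\<Phi> m\<close> is monic, so only the pairing with the \<open>m\<close>-th power is
    left.\<close>
  have \<delta>_power: "inner_power c \<delta> (int m) = 0" if "m < n" for m
    using that
  proof (induction m rule: less_induct)
    case (less m)
    have "inner_R c \<delta> (\<Phi> m) = (\<Sum>l\<le>m. if l = m then inner_power c \<delta> (int m) else 0)"
      unfolding inner_R_eq_inner_power degree
      by (rule sum.cong) (use less in \<open>auto simp: monic\<close>)
    with \<delta>_orthogonal [OF less.prems] show ?case
      by simp
  qed
  \<comment> \<open>The leading terms of \<open>\<Phi> n\<close> and \<open>monom 1 n\<close>
    cancel, so \<open>\<delta>\<close> only has coefficients below \<open>n\<close>, where
    \<open>\<delta>_power\<close> applies.\<close>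
  have \<delta>_coeff: "coeff \<delta> k = 0" if "n \<le> k" for k
  proof -
    have "coeff (\<psi> m) k = 0" if "m < n" for m
      using \<open>n \<le> k\<close> that by (simp add: \<psi>_def coeff_eq_0 degree)
    with that show ?thesis
      by (auto simp: \<delta>_def \<phi>_def coeff_sum coeff_monom monic coeff_eq_0 degree le_less)
  qed
  have "qcnj (coeff \<delta> l) * inner_power c \<delta> (int l) = 0" for l
    by (cases "l < n") (simp_all add: \<delta>_power \<delta>_coeff)
  then have "inner_R c \<delta> \<delta> = 0"
    unfolding inner_R_eq_inner_power by (intro sum.neutral) blast
  then have "\<delta> = 0"
    using inner_R_self_pos [OF pos_def, of \<delta>] by (auto simp: q_pos_def)
  then have \<phi>: "\<phi> = \<Phi> n"
    by (simp add: \<delta>_def)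
  have "orthonormal_R c n = map_poly (\<lambda>a. a /\<^sub>R sqrt (qRe (inner_R c \<phi> \<phi>))) \<phi>"
    by (subst orthonormal_R.simps) (simp add: IH \<phi>_def rmult_poly_def Let_def)
  then show ?case
    by (simp add: \<phi> diagonal rmult_poly_of_real del: of_real_inverse)
qed

section \<open>Left orthonormal polynomials as conjugates of right ones\<close>

lemma inner_L_poly_qcnj:
  "inner_L c (poly_qcnj \<phi>) (poly_qcnj \<psi>) = qcnj (inner_R (\<lambda>m. qcnj (c m)) \<phi> \<psi>)"
  by (simp add: inner_L_def inner_R_def qcnj_sum qcnj_mult mult.assoc)

text \<open>Conjugation turns left scalars into right ones and fixes the real normalizing factors,
  so it carries one Gram--Schmidt process to the other.\<close>

lemma orthonormal_L_eq_qcnj: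
  "orthonormal_L c n = poly_qcnj (orthonormal_R (\<lambda>m. qcnj (c m)) n)"
proof (induction n rule: less_induct)
  case (less n)
  define \<phi> where "\<phi> = monom 1 n - (\<Sum>k<n. map_poly
    (\<lambda>a. a * inner_R (\<lambda>m. qcnj (c m)) (monom 1 n) (orthonormal_R (\<lambda>m. qcnj (c m)) k))
    (orthonormal_R (\<lambda>m. qcnj (c m)) k))"
  \<comment> \<open>Folding this lets \<open>inner_L_poly_qcnj\<close> apply to a first argument
    that is not visibly a conjugate.\<close>
  have monom: "monom 1 n = poly_qcnj (monom 1 n)"
    by (rule poly_eqI) simp
  have "monom 1 n - (\<Sum>k<n. map_poly (\<lambda>a. inner_L c (monom 1 n) (orthonormal_L c k) * a)
      (orthonormal_L c k)) = poly_qcnj \<phi>"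
    unfolding \<phi>_def
    by (rule poly_eqI)
      (simp add: coeff_sum coeff_map_poly less qcnj_diff qcnj_sum qcnj_mult
        inner_L_poly_qcnj [of c "monom 1 n", folded monom])
  moreover have "qRe (inner_L c (poly_qcnj \<phi>) (poly_qcnj \<phi>)) =
      qRe (inner_R (\<lambda>m. qcnj (c m)) \<phi> \<phi>)"
    by (simp add: inner_L_poly_qcnj)
  ultimately have "orthonormal_L c n = map_poly
      (\<lambda>a. a /\<^sub>R sqrt (qRe (inner_R (\<lambda>m. qcnj (c m)) \<phi> \<phi>))) (poly_qcnj \<phi>)"
    by (subst orthonormal_L.simps) (simp add: Let_def)
  also have "\<dots> = poly_qcnj (map_poly
      (\<lambda>a. a /\<^sub>R sqrt (qRe (inner_R (\<lambda>m. qcnj (c m)) \<phi> \<phi>))) \<phi>)"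
    by (rule poly_eqI) (simp add: coeff_map_poly qcnj_scaleR)
  also have "\<dots> = poly_qcnj (orthonormal_R (\<lambda>m. qcnj (c m)) n)"
    by (subst orthonormal_R.simps) (simp add: Let_def \<phi>_def)
  finally show ?case .
qed


section \<open>Positive definite Toeplitz matrices\<close>

lemma sum_atMost_endpoints:
  fixes g :: "nat \<Rightarrow> 'a::comm_monoid_add"
  assumes "\<And>k. k \<noteq> 0 \<Longrightarrow> k \<noteq> n \<Longrightarrow> g k = 0" and "n \<noteq> 0"
  shows "(\<Sum>k\<le>n. g k) = g 0 + g n"
proof -
  have "(\<Sum>k\<le>n. g k) = (\<Sum>k\<in>{0, n}. g k)"
    by (rule sum.mono_neutral_right) (use assms in auto)
  with assms(2) show ?thesis by simp
qed

text \<open>Positive definiteness includes that the quadratic form is real; vectors supported on the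
  entries \<open>0\<close> and \<open>n\<close> isolate \<open>c n\<close> and
  \<open>c (- n)\<close>.\<close>

lemma toeplitz_pos_def_hermitian:
  assumes pos_def: "\<And>n. quat_pos_def n (toeplitz c)"
  shows "c (- m) = qcnj (c m)"
proof -
  have "q_pos (\<Sum>k\<le>0. \<Sum>l\<le>0. qcnj 1 * toeplitz c k l * 1)"
    by (rule quat_pos_defD [OF pos_def, of 0 0 "\<lambda>_. 1"]) simp_all
  then have c0: "qcnj (c 0) = c 0"
    by (simp add: toeplitz_def q_pos_def quat_Reals_iff)
  have nat: "c (- int n) = qcnj (c (int n))" if "n \<noteq> 0" for n
  proof -
    have real: "qcnj (c (int n) * b + qcnj b * c (- int n)) =
        c (int n) * b + qcnj b * c (- int n)" for b
    proof -
      let ?\<xi> = "\<lambda>k. if k = 0 then 1 else if k = n then b else 0 :: quat"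
      let ?term = "\<lambda>k l. qcnj (?\<xi> k) * toeplitz c k l * ?\<xi> l"
      have "q_pos (\<Sum>k\<le>n. \<Sum>l\<le>n. ?term k l)"
        by (rule quat_pos_defD [OF pos_def, of 0 n ?\<xi>]) simp_all
      also have "(\<Sum>k\<le>n. \<Sum>l\<le>n. ?term k l) = (\<Sum>l\<le>n. ?term 0 l) + (\<Sum>l\<le>n. ?term n l)"
        by (rule sum_atMost_endpoints) (use that in auto)
      also have "(\<Sum>l\<le>n. ?term 0 l) = ?term 0 0 + ?term 0 n"
        by (rule sum_atMost_endpoints) (use that in auto)
      also have "(\<Sum>l\<le>n. ?term n l) = ?term n 0 + ?term n n"
        by (rule sum_atMost_endpoints) (use that in auto)
      finally have "qcnj (c 0 + c (int n) * b + (qcnj b * c (- int n) + qcnj b * c 0 * b)) =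
          c 0 + c (int n) * b + (qcnj b * c (- int n) + qcnj b * c 0 * b)"
        using that by (simp add: toeplitz_def q_pos_def quat_Reals_iff)
      then show ?thesis
        using c0 by (simp add: qcnj_add qcnj_mult mult.assoc algebra_simps)
    qed
    \<comment> \<open>\<open>b = 1\<close> shows that the imaginary parts of the two moments are
      opposite, \<open>b = Quat 0 1 0 0\<close> that their real parts agree.\<close>
    show ?thesis
      using real [of 1] real [of "Quat 0 1 0 0"]
      by (simp add: quat_eq_iff quat_mult_sel one_quat_def)
  qed
  consider "m = 0" | "m > 0" | "m < 0"
    by linarith
  then show ?thesis
  proof cases
    case 1
    then show ?thesis by (simp add: c0)
  next
    case 2
    then show ?thesis using nat [of "nat m"] by simp
  next
    case 3
    then show ?thesis using nat [of "nat (- m)"] by simp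
  qed
qed

text \<open>Row \<open>n - k\<close> and column \<open>n - l\<close> of the Toeplitz matrix hold
  \<open>c (k - l)\<close>, so it is enough to reverse the test vector.\<close>

lemma toeplitz_pos_def_reverse:
  assumes "quat_pos_def n (toeplitz c)"
  shows "quat_pos_def n (toeplitz (\<lambda>m. c (- m)))"
  unfolding quat_pos_def_def
proof (intro allI impI)
  have rev: "(\<Sum>k\<le>n. g (n - k)) = (\<Sum>k\<le>n. g k)" for g :: "nat \<Rightarrow> quat"
    by (rule sum.reindex_bij_witness [where i = "\<lambda>k. n - k" and j = "\<lambda>k. n - k"]) auto
  fix \<xi> :: "nat \<Rightarrow> quat"
  assume "\<exists>k\<le>n. \<xi> k \<noteq> 0"
  then obtain k where k: "k \<le> n" "\<xi> k \<noteq> 0"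
    by blast
  have "q_pos (\<Sum>k\<le>n. \<Sum>l\<le>n. qcnj (\<xi> (n - k)) * toeplitz c k l * \<xi> (n - l))"
    by (rule quat_pos_defD [OF assms, of "n - k" "\<lambda>k. \<xi> (n - k)"]) (use k in simp_all)
  also have "(\<Sum>k\<le>n. \<Sum>l\<le>n. qcnj (\<xi> (n - k)) * toeplitz c k l * \<xi> (n - l)) =
      (\<Sum>k\<le>n. \<Sum>l\<le>n. qcnj (\<xi> (n - k)) * c (int (n - k) - int (n - l)) * \<xi> (n - l))"
    by (intro sum.cong) (auto simp: toeplitz_def of_nat_diff)
  also have "\<dots> = (\<Sum>k\<le>n. \<Sum>l\<le>n. qcnj (\<xi> k) * toeplitz (\<lambda>m. c (- m)) k l * \<xi> l)"
    using rev [of "\<lambda>k. \<Sum>l\<le>n. qcnj (\<xi> k) * c (int k - int (n - l)) * \<xi> (n - l)"]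
      rev [of "\<lambda>l. qcnj (\<xi> k) * c (int k - int l) * \<xi> l" for k]
    by (simp add: toeplitz_def)
  finally show "q_pos \<dots>" .
qed


section \<open>The recursion for monic orthogonal polynomials\<close>
text \<open>The monic polynomials generated by \<open>\<gamma>\<close>, with coefficients on the right. Their companions for
  the conjugate sequence are the conjugates of the left polynomials, so that the reverse of a left
  polynomial is a \<open>reflect_poly\<close>.\<close>

fun szego :: "(nat \<Rightarrow> quat) \<Rightarrow> nat \<Rightarrow> quat poly"
  where
    "szego \<gamma> 0 = [:1:]"
  | "szego \<gamma> (Suc n) = pCons 0 (szego \<gamma> n)
      - rmult_poly (reflect_poly (szego (\<lambda>k. qcnj (\<gamma> k)) n)) (qcnj (\<gamma> n))"

text \<open>The subtracted reflection has degree at most \<open>n\<close>, so the leading term comes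
  from the shift alone. \<open>\<gamma>\<close> varies in the induction because the recursion
  conjugates it.\<close>

lemma szego_monic: "degree (szego \<gamma> n) = n \<and> coeff (szego \<gamma> n) n = 1"
proof (induction n arbitrary: \<gamma>)
  case (Suc n)
  let ?\<rho> = "rmult_poly (reflect_poly (szego (\<lambda>k. qcnj (\<gamma> k)) n)) (qcnj (\<gamma> n))"
  have \<rho>: "degree ?\<rho> \<le> n"
    using Suc degree_rmult_poly_le degree_reflect_poly_le by (metis order_trans)
  then have "coeff ?\<rho> (Suc n) = 0"
    by (intro coeff_eq_0) simp
  then have lead: "coeff (szego \<gamma> (Suc n)) (Suc n) = 1"
    using Suc by simp
  have "degree (szego \<gamma> (Suc n)) \<le> Suc n"
    unfolding szego.simps
    by (rule degree_diff_le) (use Suc [of \<gamma>] \<rho> degree_pCons_le [of 0 "szego \<gamma> n"] in simp_all)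
  with lead show ?case
    by (metis antisym le_degree zero_neq_one)
qed simp

lemma degree_szego [simp]: "degree (szego \<gamma> n) = n"
  using szego_monic by blast

lemma coeff_szego_lead [simp]: "coeff (szego \<gamma> n) n = 1"
  using szego_monic by blast

text \<open>Reflection at degree \<open>Suc n\<close> exchanges the two terms of the recursion.
  Coefficients are compared directly: the companion may have constant term zero, and then reflecting
  it twice does not give it back.\<close>

lemma reflect_szego_Suc:
  "reflect_poly (szego \<gamma> (Suc n)) =
    reflect_poly (szego \<gamma> n) - rmult_poly (pCons 0 (szego (\<lambda>k. qcnj (\<gamma> k)) n)) (qcnj (\<gamma> n))"
proof (rule poly_eqI)
  fix k
  let ?\<phi> = "szego \<gamma> n" and ?\<psi> = "szego (\<lambda>k. qcnj (\<gamma> k)) n"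
  have "coeff (reflect_poly (szego \<gamma> (Suc n))) k =
      (if Suc n < k then 0 else coeff (szego \<gamma> (Suc n)) (Suc n - k))"
    by (simp only: coeff_reflect_poly degree_szego)
  also have "\<dots> = coeff (reflect_poly ?\<phi> - rmult_poly (pCons 0 ?\<psi>) (qcnj (\<gamma> n))) k"
  proof (cases k)
    case 0
    then show ?thesis
      using coeff_szego_lead [of \<gamma> "Suc n"] by (simp del: szego.simps)
  next
    case (Suc m)
    consider "m < n" | "m = n" | "n < m"
      by linarith
    then show ?thesis
    proof cases
      case 1
      then have "n - m = Suc (n - Suc m)" "\<not> n < Suc (n - Suc m)"
        by auto
      with 1 Suc show ?thesis
        by (simp add: coeff_reflect_poly)
    qed (use Suc in \<open>simp_all add: coeff_reflect_poly coeff_eq_0\<close>)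
  qed
  finally show "coeff (reflect_poly (szego \<gamma> (Suc n))) k =
    coeff (reflect_poly ?\<phi> - rmult_poly (pCons 0 ?\<psi>) (qcnj (\<gamma> n))) k" .
qed

lemma inner_power_szego_Suc:
  "inner_power c (szego \<gamma> (Suc n)) l = inner_power c (szego \<gamma> n) (l - 1)
    - inner_power (\<lambda>m. c (- m)) (szego (\<lambda>k. qcnj (\<gamma> k)) n) (int n - l) * qcnj (\<gamma> n)"
  by (simp add: inner_power_diff inner_power_pCons_0 inner_power_rmult_poly inner_power_reflect_poly)

text \<open>The series called \<open>G n\<close> in the introductory text. Its recursion involves no
  polynomials; \<open>szego_invariant\<close> ties it to the inner products.\<close>

fun szego_residual ::
    "(int \<Rightarrow> quat) \<Rightarrow> (nat \<Rightarrow> quat) \<Rightarrow> (nat \<Rightarrow> quat fps) \<Rightarrow> nat \<Rightarrow> quat fps"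
  where
    "szego_residual c \<gamma> f 0 = Abs_fps (\<lambda>n. c (- int n))"
  | "szego_residual c \<gamma> f (Suc n) = szego_residual c \<gamma> f n * (1 - f n * fps_const (qcnj (\<gamma> n)))"

text \<open>As \<open>\<gamma> k\<close> is the constant term of \<open>f k\<close>, each factor
  contributes a real number. The product will be the squared norm of the \<open>n\<close>-th monic
  polynomial.\<close>

lemma szego_residual_0:
  assumes "c 0 = 1" and "\<And>n. \<gamma> n = fps_nth (f n) 0"
  shows "fps_nth (szego_residual c \<gamma> f n) 0 = of_real (\<Prod>k<n. 1 - (norm (\<gamma> k))\<^sup>2)"
  by (induction n) (simp_all add: assms(1) mult_qcnj flip: assms(2))

text \<open>The hypotheses are invariant under quaternionic conjugation of \<open>c\<close>, \<open>\<gamma>\<close> and \<open>f\<close>, which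
  exchanges the left and the right polynomials.\<close>

locale schur_data =
  fixes c :: "int \<Rightarrow> quat" and \<gamma> :: "nat \<Rightarrow> quat" and f :: "nat \<Rightarrow> quat fps"
  assumes c_0: "c 0 = 1"
    and hermitian: "c (- m) = qcnj (c m)"
    and pos_def: "quat_pos_def n (toeplitz c)"
    and initial:
      "Abs_fps (\<lambda>n. c (- int n)) * (1 - fps_X * f 0) = 1"
      "(1 - fps_X * f 0) * Abs_fps (\<lambda>n. c (- int n)) = 1"
    and \<gamma>: "\<gamma> n = fps_nth (f n) 0"
    and step:
      "norm (\<gamma> n) < 1 \<Longrightarrow>
        (1 - f n * fps_const (qcnj (\<gamma> n))) * (fps_X * f (Suc n)) = f n - fps_const (\<gamma> n)"
      "norm (\<gamma> n) < 1 \<Longrightarrow>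
        (fps_X * f (Suc n)) * (1 - fps_const (qcnj (\<gamma> n)) * f n) = f n - fps_const (\<gamma> n)"
begin

text \<open>Conjugation reverses products and so exchanges the two members of \<open>initial\<close>
  and of \<open>step\<close>; this is why both orders are assumed.\<close>

lemma dual: "schur_data (\<lambda>m. c (- m)) (\<lambda>k. qcnj (\<gamma> k)) (\<lambda>k. fps_qcnj (f k))"
proof
  have c_conj: "Abs_fps (\<lambda>n. c (int n)) = fps_qcnj (Abs_fps (\<lambda>n. c (- int n)))"
    by (rule fps_ext) (simp add: hermitian)
  show "Abs_fps (\<lambda>n. c (- (- int n))) * (1 - fps_X * fps_qcnj (f 0)) = 1"
    using arg_cong [OF initial(2), of fps_qcnj]
    by (simp add: c_conj fps_qcnj_mult fps_mult_fps_X_commute)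
  show "(1 - fps_X * fps_qcnj (f 0)) * Abs_fps (\<lambda>n. c (- (- int n))) = 1"
    using arg_cong [OF initial(1), of fps_qcnj]
    by (simp add: c_conj fps_qcnj_mult fps_mult_fps_X_commute)
  fix n
  assume "norm (qcnj (\<gamma> n)) < 1"
  then have n: "norm (\<gamma> n) < 1"
    by simp
  show "(1 - fps_qcnj (f n) * fps_const (qcnj (qcnj (\<gamma> n)))) * (fps_X * fps_qcnj (f (Suc n))) =
      fps_qcnj (f n) - fps_const (qcnj (\<gamma> n))"
    using arg_cong [OF step(2) [OF n], of fps_qcnj]
    by (simp add: fps_qcnj_mult fps_mult_fps_X_commute)
  show "(fps_X * fps_qcnj (f (Suc n))) * (1 - fps_const (qcnj (qcnj (\<gamma> n))) * fps_qcnj (f n)) =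
      fps_qcnj (f n) - fps_const (qcnj (\<gamma> n))"
    using arg_cong [OF step(1) [OF n], of fps_qcnj]
    by (simp add: fps_qcnj_mult fps_mult_fps_X_commute)
next
  show "quat_pos_def n (toeplitz (\<lambda>m. c (- m)))" for n
    by (rule toeplitz_pos_def_reverse) (rule pos_def)
qed (simp_all add: c_0 hermitian \<gamma>)

end

text \<open>Evaluating \<open>f n\<close> at \<open>0\<close> in the last property shows that \<open>\<gamma> n\<close> is the parameter for which
  the next polynomial is orthogonal to \<open>1\<close>.\<close>

definition szego_invariant ::
    "(int \<Rightarrow> quat) \<Rightarrow> (nat \<Rightarrow> quat) \<Rightarrow> (nat \<Rightarrow> quat fps) \<Rightarrow> nat \<Rightarrow> bool"
  where "szego_invariant c \<gamma> f n \<longleftrightarrow>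
    (\<forall>l<n. inner_power c (szego \<gamma> n) (int l) = 0) \<and>
    (\<forall>m. inner_power c (szego \<gamma> n) (int (n + m)) = fps_nth (szego_residual c \<gamma> f n) m) \<and>
    (\<forall>m. inner_power (\<lambda>m. c (- m)) (szego (\<lambda>k. qcnj (\<gamma> k)) n) (- 1 - int m) =
      fps_nth (szego_residual c \<gamma> f n * f n) m)"

context schur_data
begin

text \<open>The product is the squared norm of a nonzero polynomial. Only part of the invariant is
  assumed, so that \<open>norm (\<gamma> n) < 1\<close> is available before the last property for
  \<open>Suc n\<close>, whose proof needs it.\<close>

lemma residual_0_pos:
  assumes "\<And>l. l < n \<Longrightarrow> inner_power c (szego \<gamma> n) (int l) = 0"
    and "inner_power c (szego \<gamma> n) (int n) = fps_nth (szego_residual c \<gamma> f n) 0"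
  shows "0 < (\<Prod>k<n. 1 - (norm (\<gamma> k))\<^sup>2)"
proof -
  have "inner_R c (szego \<gamma> n) (szego \<gamma> n) =
      (\<Sum>l\<le>n. if l = n then inner_power c (szego \<gamma> n) (int n) else 0)"
    unfolding inner_R_eq_inner_power degree_szego
    by (rule sum.cong) (use assms(1) in auto)
  also have "\<dots> = of_real (\<Prod>k<n. 1 - (norm (\<gamma> k))\<^sup>2)"
    using assms(2) szego_residual_0 [of c \<gamma> f n, OF c_0 \<gamma>] by simp
  finally have "q_pos (of_real (\<Prod>k<n. 1 - (norm (\<gamma> k))\<^sup>2))"
    using inner_R_self_pos [of c "szego \<gamma> n", OF pos_def] coeff_szego_lead [of \<gamma> n]
    by (metis coeff_0 zero_neq_one)
  then show ?thesis
    by (simp only: q_pos_of_real)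
qed

lemma szego_invariant_0: "szego_invariant c \<gamma> f 0"
proof -
  let ?g = "Abs_fps (\<lambda>n. c (- int n))"
  \<comment> \<open>Since \<open>?g\<close> inverts \<open>1 - fps_X * f 0\<close>, the series
    \<open>?g * f 0\<close> is \<open>?g\<close> without its constant term, shifted by one.\<close>
  have "?g * f 0 * fps_X = ?g - 1"
    using initial(1) by (simp add: algebra_simps fps_mult_fps_X_commute)
  then have "fps_nth (?g * f 0) m = c (- int (Suc m))" for m
    by (metis (no_types, lifting) diff_Suc_1 diff_zero fps_X_mult_right_nth fps_nth_Abs_fps
        fps_one_nth fps_sub_nth nat.distinct(1))
  then show ?thesis
    by (simp add: szego_invariant_def inner_power_def algebra_simps)
qed

lemma szego_invariant_Suc:
  assumes "szego_invariant c \<gamma> f n"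
    and "szego_invariant (\<lambda>m. c (- m)) (\<lambda>k. qcnj (\<gamma> k)) (\<lambda>k. fps_qcnj (f k)) n"
  shows "szego_invariant c \<gamma> f (Suc n) \<and> norm (\<gamma> n) < 1"
proof -
  interpret d: schur_data "\<lambda>m. c (- m)" "\<lambda>k. qcnj (\<gamma> k)" "\<lambda>k. fps_qcnj (f k)"
    by (rule dual)
  let ?u = "\<lambda>n. inner_power c (szego \<gamma> n)"
  let ?v = "\<lambda>n. inner_power (\<lambda>m. c (- m)) (szego (\<lambda>k. qcnj (\<gamma> k)) n)"
  let ?G = "szego_residual c \<gamma> f"
  let ?H = "szego_residual (\<lambda>m. c (- m)) (\<lambda>k. qcnj (\<gamma> k)) (\<lambda>k. fps_qcnj (f k))"
  have u: "\<And>l. l < n \<Longrightarrow> ?u n (int l) = 0"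
      "\<And>m. ?u n (int (n + m)) = fps_nth (?G n) m"
      "\<And>m. ?v n (- 1 - int m) = fps_nth (?G n * f n) m"
    using assms(1) by (auto simp: szego_invariant_def)
  have v: "\<And>l. l < n \<Longrightarrow> ?v n (int l) = 0"
      "\<And>m. ?v n (int (n + m)) = fps_nth (?H n) m"
      "\<And>m. ?u n (- 1 - int m) = fps_nth (?H n * fps_qcnj (f n)) m"
    using assms(2) by (auto simp: szego_invariant_def)
  have u_Suc: "?u (Suc n) l = ?u n (l - 1) - ?v n (int n - l) * qcnj (\<gamma> n)" for l
    by (rule inner_power_szego_Suc)
  have v_Suc: "?v (Suc n) l = ?v n (l - 1) - ?u n (int n - l) * \<gamma> n" for l
    using inner_power_szego_Suc [of "\<lambda>m. c (- m)" "\<lambda>k. qcnj (\<gamma> k)" n l] by simp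
  have low: "?u (Suc n) (int l) = 0" if "l < Suc n" for l
  proof (cases l)
    \<comment> \<open>The choice of \<open>\<gamma> n\<close> matters here: both terms of
      \<open>u_Suc\<close> equal \<open>fps_nth (?H n) 0 * qcnj (\<gamma> n)\<close> and
      cancel.\<close>
    case 0
    then show ?thesis
      using u_Suc [of 0] v(2) [of 0] v(3) [of 0] by (simp flip: \<gamma>)
  next
    case (Suc k)
    then have "int n - int l = int (n - l)" "n - l < n" "k < n"
      using that by auto
    then show ?thesis
      using u_Suc [of "int l"] u(1) [of k] v(1) [of "n - l"] Suc by simp
  qed
  have high: "?u (Suc n) (int (Suc n + m)) = fps_nth (?G (Suc n)) m" for m
  proof -
    have "?u (Suc n) (int (Suc n + m)) = ?u n (int (n + m)) - ?v n (- 1 - int m) * qcnj (\<gamma> n)"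
      using u_Suc [of "int (Suc n + m)"] by (simp add: algebra_simps)
    also have "\<dots> = fps_nth (?G (Suc n)) m"
      unfolding u by (simp add: right_diff_distrib flip: mult.assoc)
    finally show ?thesis .
  qed
  \<comment> \<open>Two consecutive products are positive, hence so is the last factor.\<close>
  have "0 < (\<Prod>k<Suc n. 1 - (norm (\<gamma> k))\<^sup>2)"
    using low high [of 0] by (intro residual_0_pos) simp_all
  moreover have "0 < (\<Prod>k<n. 1 - (norm (\<gamma> k))\<^sup>2)"
    using u(1) u(2) [of 0] by (intro residual_0_pos) simp_all
  ultimately have "(norm (\<gamma> n))\<^sup>2 < 1"
    by (simp add: zero_less_mult_iff)
  then have \<gamma>_less: "norm (\<gamma> n) < 1"
    by (simp add: power_less_one_iff abs_square_less_1)
  have "?v (Suc n) (- 1 - int m) = fps_nth (?G (Suc n) * f (Suc n)) m" for m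
  proof -
    have "?v (Suc n) (- 1 - int m) = ?v n (- 1 - int (Suc m)) - ?u n (int (n + Suc m)) * \<gamma> n"
      using v_Suc [of "- 1 - int m"] by (simp add: algebra_simps)
    also have "\<dots> = fps_nth (?G n * (f n - fps_const (\<gamma> n))) (Suc m)"
      unfolding u by (simp add: right_diff_distrib)
    \<comment> \<open>The bound \<open>\<gamma>_less\<close> makes \<open>step\<close> applicable,
      and its left factor is the one that turns \<open>?G n\<close> into
      \<open>?G (Suc n)\<close>.\<close>
    also have "?G n * (f n - fps_const (\<gamma> n)) = fps_X * (?G (Suc n) * f (Suc n))"
      unfolding step(1) [OF \<gamma>_less, symmetric]
      by (simp add: fps_mult_fps_X_commute mult.assoc)
    finally show ?thesis by simp
  qed
  with low high \<gamma>_less show ?thesis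
    unfolding szego_invariant_def by blast
qed

end

text \<open>The induction runs over all data at once, since each step also needs the invariant of
  the dual data.\<close>

lemma schur_data_invariant: "schur_data c \<gamma> f \<Longrightarrow> szego_invariant c \<gamma> f n"
proof (induction n arbitrary: c \<gamma> f)
  case 0
  then show ?case
    by (rule schur_data.szego_invariant_0)
next
  case (Suc n)
  interpret schur_data c \<gamma> f by fact
  show ?case
    using szego_invariant_Suc Suc.IH [OF Suc.prems] Suc.IH [OF dual] by blast
qed

section \<open>From monic to orthonormal polynomials\<close>

context schur_data
begin

lemma norm_\<gamma>_less_1: "norm (\<gamma> n) < 1"
  using szego_invariant_Suc schur_data_invariant [OF dual]
    schur_data_invariant [OF schur_data_axioms] by blast

definition squared_norm :: "nat \<Rightarrow> real"
  where "squared_norm n = (\<Prod>k<n. 1 - (norm (\<gamma> k))\<^sup>2)"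

lemma squared_norm_pos: "0 < squared_norm n"
  unfolding squared_norm_def
  by (intro prod_pos) (use norm_\<gamma>_less_1 in \<open>simp add: abs_square_less_1\<close>)

lemma orthonormal_R_eq_szego:
  "orthonormal_R c n = rmult_poly (szego \<gamma> n) (of_real (inverse (sqrt (squared_norm n))))"
proof (rule orthonormal_R_eq_monic_orthogonal)
  have inv: "szego_invariant c \<gamma> f n" for n
    by (rule schur_data_invariant) (rule schur_data_axioms)
  show "inner_power c (szego \<gamma> n) (int l) = 0" if "l < n" for n l
    using inv [of n] that by (simp add: szego_invariant_def)
  show "inner_power c (szego \<gamma> n) (int n) = of_real (squared_norm n)" for n
  proof -
    have "inner_power c (szego \<gamma> n) (int (n + 0)) = fps_nth (szego_residual c \<gamma> f n) 0"
      using inv [of n] unfolding szego_invariant_def by blast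
    then show ?thesis
      using szego_residual_0 [of c \<gamma> f n, OF c_0 \<gamma>] by (simp add: squared_norm_def)
  qed
qed (use hermitian pos_def squared_norm_pos in auto)

lemma orthonormal_R_dual_eq_szego:
  "orthonormal_R (\<lambda>m. c (- m)) n =
    rmult_poly (szego (\<lambda>k. qcnj (\<gamma> k)) n) (of_real (inverse (sqrt (squared_norm n))))"
proof -
  interpret d: schur_data "\<lambda>m. c (- m)" "\<lambda>k. qcnj (\<gamma> k)" "\<lambda>k. fps_qcnj (f k)"
    by (rule dual)
  show ?thesis
    using d.orthonormal_R_eq_szego by (simp add: squared_norm_def d.squared_norm_def)
qed

text \<open>Both polynomials entering the monic recursion carry the same normalizing factor, and
  passing to \<open>Suc n\<close> divides it by \<open>r n\<close>.\<close>

theorem szego_recursion_R: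
  defines "r n \<equiv> sqrt (1 - (norm (\<gamma> n))\<^sup>2)"
  shows "eval_rcoeff (orthonormal_R c (Suc n)) p =
      inverse (r n) *\<^sub>R (p * eval_rcoeff (orthonormal_R c n) p
        - eval_rcoeff (reflect_poly (orthonormal_R (\<lambda>m. c (- m)) n)) p * qcnj (\<gamma> n))"
    and "eval_rcoeff (reflect_poly (orthonormal_R (\<lambda>m. c (- m)) (Suc n))) p =
      inverse (r n) *\<^sub>R (eval_rcoeff (reflect_poly (orthonormal_R (\<lambda>m. c (- m)) n)) p
        - p * eval_rcoeff (orthonormal_R c n) p * \<gamma> n)"
proof -
  define s where "s n = inverse (sqrt (squared_norm n))" for n
  have s_Suc: "s (Suc n) = inverse (r n) * s n"
    by (simp add: s_def r_def squared_norm_def real_sqrt_mult)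
  have s_nz: "of_real (s n) \<noteq> (0 :: quat)" for n
    using squared_norm_pos [of n] by (simp add: s_def)
  have scale: "eval_rcoeff (rmult_poly \<phi> (of_real a)) p = a *\<^sub>R eval_rcoeff \<phi> p" for \<phi> a
    by (simp add: eval_rcoeff_rmult_poly quat_eq_iff quat_mult_sel)
  have dual_Suc: "reflect_poly (szego (\<lambda>k. qcnj (\<gamma> k)) (Suc n)) =
      reflect_poly (szego (\<lambda>k. qcnj (\<gamma> k)) n) - rmult_poly (pCons 0 (szego \<gamma> n)) (\<gamma> n)"
    using reflect_szego_Suc [of "\<lambda>k. qcnj (\<gamma> k)" n] by simp
  note eqs = orthonormal_R_eq_szego orthonormal_R_dual_eq_szego
    reflect_poly_rmult_poly [OF s_nz] scale
  show "eval_rcoeff (orthonormal_R c (Suc n)) p =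
      inverse (r n) *\<^sub>R (p * eval_rcoeff (orthonormal_R c n) p
        - eval_rcoeff (reflect_poly (orthonormal_R (\<lambda>m. c (- m)) n)) p * qcnj (\<gamma> n))"
    unfolding eqs s_def [symmetric] unfolding s_Suc szego.simps
    by (simp add: eval_rcoeff_diff eval_rcoeff_pCons_0 eval_rcoeff_rmult_poly algebra_simps)
  show "eval_rcoeff (reflect_poly (orthonormal_R (\<lambda>m. c (- m)) (Suc n))) p =
      inverse (r n) *\<^sub>R (eval_rcoeff (reflect_poly (orthonormal_R (\<lambda>m. c (- m)) n)) p
        - p * eval_rcoeff (orthonormal_R c n) p * \<gamma> n)"
    unfolding eqs s_def [symmetric] unfolding s_Suc dual_Suc
    by (simp add: eval_rcoeff_diff eval_rcoeff_pCons_0 eval_rcoeff_rmult_poly algebra_simps)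
qed

end


section \<open>The Schur algorithm\<close>

text \<open>The equality of the two fractions rests on \<open>\<gamma> * qcnj \<gamma> = qcnj \<gamma> * \<gamma>\<close>, a real number.\<close>

lemma schur_step_commute:
  fixes g :: "quat fps"
  shows "(1 - g * fps_const (qcnj a)) * (g - fps_const a) =
    (g - fps_const a) * (1 - fps_const (qcnj a) * g)"
proof -
  have "fps_const (qcnj a) * fps_const a = fps_const (of_real ((norm a)\<^sup>2))"
    "fps_const a * fps_const (qcnj a) = fps_const (of_real ((norm a)\<^sup>2))"
    by (simp_all add: mult_qcnj qcnj_mult_self del: of_real_power)
  moreover have "g * fps_const (of_real x) = fps_const (of_real x) * g" for x
    by (rule fps_ext) (simp add: quat_eq_iff quat_mult_sel)
  ultimately have "g * (fps_const (qcnj a) * fps_const a) = fps_const a * fps_const (qcnj a) * g"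
    by (simp only:)
  then show ?thesis
    by (simp add: algebra_simps del: fps_const_mult)
qed

text \<open>The denominator has the nonzero constant term \<open>1 - (norm a)\<^sup>2\<close>, so
  \<open>inverse\<close> is a two-sided inverse; \<open>schur_step_commute\<close> moves the
  denominator to the left.\<close>

lemma schur_iterate_Suc:
  assumes "norm (fps_nth (schur_iterate f n) 0) < 1"
  defines "g \<equiv> schur_iterate f n" and "a \<equiv> fps_nth (schur_iterate f n) 0"
  shows "(fps_X * schur_iterate f (Suc n)) * (1 - fps_const (qcnj a) * g) = g - fps_const a"
    and "(1 - g * fps_const (qcnj a)) * (fps_X * schur_iterate f (Suc n)) = g - fps_const a"
proof -
  let ?d = "1 - fps_const (qcnj a) * g"
  have "fps_nth ?d 0 = of_real (1 - (norm a)\<^sup>2)"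
    by (simp add: a_def g_def qcnj_mult_self)
  moreover have "1 - (norm a)\<^sup>2 > 0"
    using assms(1) by (simp add: a_def abs_square_less_1)
  ultimately have d: "fps_nth ?d 0 \<noteq> 0"
    by (metis of_real_eq_0_iff less_irrefl)
  \<comment> \<open>The constant term of \<open>g - fps_const a\<close> is zero, so
    \<open>fps_X\<close> undoes the shift.\<close>
  have X: "fps_X * schur_iterate f (Suc n) = (g - fps_const a) * inverse ?d"
    by (rule fps_ext) (simp add: Let_def g_def a_def)
  then show "(fps_X * schur_iterate f (Suc n)) * ?d = g - fps_const a"
    using inverse_mult_eq_1 [OF d] by (simp add: mult.assoc)
  have "(1 - g * fps_const (qcnj a)) * ((g - fps_const a) * inverse ?d) =
      (g - fps_const a) * (?d * inverse ?d)"
    by (simp only: schur_step_commute flip: mult.assoc)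
  then show "(1 - g * fps_const (qcnj a)) * (fps_X * schur_iterate f (Suc n)) = g - fps_const a"
    using inverse_mult_eq_1' [OF d] by (simp only: X mult_1_right)
qed

lemma verblunsky_coeffs_schur_data:
  assumes "c 0 = 1" and pos_def: "\<And>n. quat_pos_def n (toeplitz c)"
    and "verblunsky_coeffs c \<gamma>"
  shows "\<exists>f. schur_data c \<gamma> f"
proof -
  obtain f where F: "caratheodory_series c = (1 + fps_X * f) * inverse (1 - fps_X * f)"
    and \<gamma>: "\<And>n. \<gamma> n = fps_nth (schur_iterate f n) 0"
    using assms(3) unfolding verblunsky_coeffs_def by blast
  let ?d = "1 - fps_X * f" and ?g = "Abs_fps (\<lambda>n. c (- int n))"
  have d: "fps_nth ?d 0 \<noteq> 0"
    by simp
  \<comment> \<open>The numerator plus \<open>?d\<close> is \<open>2\<close>. Hence half of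
    \<open>caratheodory_series c + 1\<close>, which is \<open>?g\<close> because
    \<open>c 0 = 1\<close>, inverts \<open>?d\<close>.\<close>
  have "caratheodory_series c + 1 = ((1 + fps_X * f) + ?d) * inverse ?d"
    using inverse_mult_eq_1' [OF d] by (simp only: F distrib_right)
  then have sum: "caratheodory_series c + 1 = inverse ?d + inverse ?d"
    by (simp flip: mult_2)
  have "?g = inverse ?d"
  proof (rule fps_ext)
    fix n
    have "fps_nth ?g n + fps_nth ?g n = fps_nth (caratheodory_series c + 1) n"
      by (cases n) (simp_all add: caratheodory_series_def assms(1) mult_2)
    also have "\<dots> = fps_nth (inverse ?d) n + fps_nth (inverse ?d) n"
      by (simp add: sum)
    finally show "fps_nth ?g n = fps_nth (inverse ?d) n"
      by (simp add: quat_eq_iff)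
  qed
  moreover note inverse_mult_eq_1 [OF d] inverse_mult_eq_1' [OF d]
  ultimately have "schur_data c \<gamma> (schur_iterate f)"
    using assms(1) toeplitz_pos_def_hermitian [OF pos_def] pos_def \<gamma> schur_iterate_Suc [of f]
    by unfold_locales simp_all
  then show ?thesis by blast
qed

theorem corollary5p4:
  fixes i j :: quat and \<mu> :: "quat set \<Rightarrow> quat"
    and c :: "int \<Rightarrow> quat" and \<gamma> :: "nat \<Rightarrow> quat"
    and r :: "nat \<Rightarrow> real" and \<psi>L \<psi>R :: "nat \<Rightarrow> quat poly"
  assumes "i \<in> imag_units" and "j \<in> imag_units" and "inner i j = 0"
    and "q_positive i j \<mu>"
    and "\<And>n. c n = moment i \<mu> n"
    and "c 0 = 1"
    and "q_nontrivial i \<mu>"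
    and "verblunsky_coeffs c \<gamma>"
    and "\<And>n. \<psi>L n = orthonormal_L c n"
    and "\<And>n. \<psi>R n = orthonormal_R c n"
    and "\<And>n. r n = sqrt (1 - (norm (\<gamma> n))\<^sup>2)"
  shows "\<forall>(n :: nat) (p :: quat).
      eval_lcoeff (\<psi>L (n + 1)) p =
        inverse (r n) *\<^sub>R (eval_lcoeff (\<psi>L n) p * p
                           - qcnj (\<gamma> n) * eval_lcoeff (reverse_poly (\<psi>R n)) p) \<and>
      eval_rcoeff (reverse_poly (\<psi>L (n + 1))) p =
        inverse (r n) *\<^sub>R (eval_rcoeff (reverse_poly (\<psi>L n)) p
                           - p * eval_rcoeff (\<psi>R n) p * \<gamma> n) \<and>
      eval_rcoeff (\<psi>R (n + 1)) p =
        inverse (r n) *\<^sub>R (p * eval_rcoeff (\<psi>R n) p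
                           - eval_rcoeff (reverse_poly (\<psi>L n)) p * qcnj (\<gamma> n)) \<and>
      eval_lcoeff (reverse_poly (\<psi>R (n + 1))) p =
        inverse (r n) *\<^sub>R (eval_lcoeff (reverse_poly (\<psi>R n)) p
                           - \<gamma> n * eval_lcoeff (\<psi>L n) p * p)"
proof (intro allI)
  fix n :: nat and p :: quat
  let ?c' = "\<lambda>m. c (- m)"
  have pos_def: "\<And>n. quat_pos_def n (toeplitz c)"
    using assms(5,7) by (simp add: q_nontrivial_def toeplitz_def quat_pos_def_def)
  obtain f where "schur_data c \<gamma> f"
    using verblunsky_coeffs_schur_data [OF assms(6) pos_def assms(8)] by blast
  then interpret schur_data c \<gamma> f .
  interpret d: schur_data ?c' "\<lambda>k. qcnj (\<gamma> k)" "\<lambda>k. fps_qcnj (f k)"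
    by (rule dual)
  \<comment> \<open>By hermitian symmetry the conjugate moments are those of the dual data.\<close>
  have "(\<lambda>m. qcnj (c m)) = ?c'"
    by (simp add: hermitian)
  then have L: "\<psi>L n = poly_qcnj (orthonormal_R ?c' n)" for n
    by (simp add: assms(9) orthonormal_L_eq_qcnj)
  have rev_L: "reverse_poly (\<psi>L n) = reflect_poly (orthonormal_R ?c' n)" for n
    by (simp add: L reverse_poly_qcnj)
  have rev_R: "reverse_poly (\<psi>R n) = poly_qcnj (reflect_poly (orthonormal_R c n))" for n
    by (simp add: assms(10) reverse_poly_eq)
  \<comment> \<open>\<open>right\<close> gives the second and third identities; \<open>left\<close>,
    the recursion for the dual data at \<open>qcnj p\<close>, gives the first and fourth after
    conjugation.\<close>
  note right = szego_recursion_R [of n p]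
  note left = d.szego_recursion_R [of n "qcnj p", simplified]
  show "eval_lcoeff (\<psi>L (n + 1)) p =
        inverse (r n) *\<^sub>R (eval_lcoeff (\<psi>L n) p * p
                           - qcnj (\<gamma> n) * eval_lcoeff (reverse_poly (\<psi>R n)) p) \<and>
      eval_rcoeff (reverse_poly (\<psi>L (n + 1))) p =
        inverse (r n) *\<^sub>R (eval_rcoeff (reverse_poly (\<psi>L n)) p
                           - p * eval_rcoeff (\<psi>R n) p * \<gamma> n) \<and>
      eval_rcoeff (\<psi>R (n + 1)) p =
        inverse (r n) *\<^sub>R (p * eval_rcoeff (\<psi>R n) p
                           - eval_rcoeff (reverse_poly (\<psi>L n)) p * qcnj (\<gamma> n)) \<and>
      eval_lcoeff (reverse_poly (\<psi>R (n + 1))) p =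
        inverse (r n) *\<^sub>R (eval_lcoeff (reverse_poly (\<psi>R n)) p
                           - \<gamma> n * eval_lcoeff (\<psi>L n) p * p)"
    unfolding rev_L rev_R unfolding L assms(10) assms(11) eval_lcoeff_poly_qcnj Suc_eq_plus1 [symmetric]
    using right left by (simp add: qcnj_scaleR qcnj_diff qcnj_mult mult.assoc)
qed

end
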